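(* Let $A\in\mathbb{R}^{n\times n}$ be symmetric, let $B\in\mathbb{R}^{n\times n}$ be symmetric positive definite, and put $C=B^{-1}A$. Let $Q\in\mathbb{R}^{n\times m}$ be a fixed matrix with $B$-orthonormal columns, i.e. $Q^*BQ=I$. Fix a positive integer $r$ and a real number $\alpha>1$, and let $\omega_1,\dots,\omega_r\in\mathbb{R}^n$ be independent random vectors, each with i.i.d. standard normal entries. Then the inequality $$\|(I-QQ^*B)C\|_B\;\le\;\alpha\sqrt{\frac{2\|B^{-1}\|_2}{\pi}}\;\max_{i=1,\dots,r}\|(I-QQ^*B)C\omega_i\|_B$$ holds with probability at least $1-\alpha^{-r}$.
   Context: For a vector $x$, $\|x\|_B=\sqrt{x^*Bx}$. For a square matrix $M$, $\|M\|_B=\max_{\|x\|_B=1}\|Mx\|_B$ is the induced norm (equivalently $\|M\|_B=\|B^{1/2}MB^{-1/2}\|_2$). $\|\cdot\|_2$ denotes the Euclidean vector norm and the induced spectral matrix norm. *)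

theory Defs
  imports "HOL-Probability.Probability"
begin

definition symmetric_matrix :: "real ^ 'n ^ 'n \<Rightarrow> bool" where
  "symmetric_matrix A \<longleftrightarrow> transpose A = A"

definition pos_def_matrix :: "real ^ 'n ^ 'n \<Rightarrow> bool" where
  "pos_def_matrix B \<longleftrightarrow> (\<forall>x. x \<noteq> 0 \<longrightarrow> 0 < x \<bullet> (B *v x))"

definition vec_norm_wrt :: "real ^ 'n ^ 'n \<Rightarrow> real ^ 'n \<Rightarrow> real" where
  "vec_norm_wrt B x = sqrt (x \<bullet> (B *v x))"

text \<open>For positive definite \<open>B\<close> the unit sphere of \<open>vec_norm_wrt B\<close> is compact and nonempty,
  so the supremum is a maximum (lemma \<open>mat_norm_wrt_attained\<close>).\<close>

definition mat_norm_wrt :: "real ^ 'n ^ 'n \<Rightarrow> real ^ 'n ^ 'n \<Rightarrow> real" where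
  "mat_norm_wrt B M = (SUP x\<in>{x. vec_norm_wrt B x = 1}. vec_norm_wrt B (M *v x))"

lemma mat_norm_wrt_attained:
  fixes B M :: "real ^ 'n ^ 'n"
  assumes "pos_def_matrix B"
  shows "\<exists>x. vec_norm_wrt B x = 1 \<and> vec_norm_wrt B (M *v x) = mat_norm_wrt B M
           \<and> (\<forall>y. vec_norm_wrt B y = 1 \<longrightarrow> vec_norm_wrt B (M *v y) \<le> vec_norm_wrt B (M *v x))"
proof -
  let ?q = "\<lambda>x :: real ^ 'n. x \<bullet> (B *v x)"
  let ?S = "{x. vec_norm_wrt B x = 1}"
  have pos: "x \<noteq> 0 \<Longrightarrow> 0 < ?q x" for x
    using assms by (auto simp: pos_def_matrix_def)
  have contq: "continuous_on T ?q" for T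
    by (intro continuous_intros)
  have contn: "continuous_on T (vec_norm_wrt B)" for T
    unfolding vec_norm_wrt_def by (intro continuous_intros)
  have scale: "?q (c *\<^sub>R x) = c\<^sup>2 * ?q x" for c x
    by (simp add: matrix_vector_mult_scaleR power2_eq_square)
  have ne_sph: "sphere (0 :: real ^ 'n) 1 \<noteq> {}" by simp
  obtain u :: "real ^ 'n" where u: "norm u = 1"
    and umin: "\<And>y. norm y = 1 \<Longrightarrow> ?q u \<le> ?q y"
    using continuous_attains_inf[OF compact_sphere ne_sph contq] by auto
  have qu: "0 < ?q u" using u pos[of u] by force
  have lower: "?q u * (norm x)\<^sup>2 \<le> ?q x" for x
  proof (cases "x = 0")
    case False
    define y where "y = (1 / norm x) *\<^sub>R x"
    have "norm y = 1" using False by (simp add: y_def)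
    then have "?q u \<le> (1 / norm x)\<^sup>2 * ?q x"
      using umin[of y] unfolding y_def scale by blast
    then show ?thesis using False by (simp add: field_simps)
  qed simp
  have "norm x \<le> sqrt (1 / ?q u)" if "x \<in> ?S" for x
  proof -
    have "?q x = 1" using that by (simp add: vec_norm_wrt_def)
    then have "(norm x)\<^sup>2 \<le> 1 / ?q u"
      using lower[of x] qu by (simp add: field_simps)
    then show ?thesis by (rule real_le_rsqrt)
  qed
  then have "bounded ?S" by (auto simp: bounded_iff)
  moreover have "closed ?S"
    by (intro closed_Collect_eq contn continuous_on_const)
  ultimately have comp: "compact ?S" by (simp add: compact_eq_bounded_closed)
  have "?q ((1 / sqrt (?q u)) *\<^sub>R u) = 1"
    unfolding scale using qu by (simp add: power_divide)
  then have "(1 / sqrt (?q u)) *\<^sub>R u \<in> ?S"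
    by (simp only: mem_Collect_eq vec_norm_wrt_def real_sqrt_one)
  then have ne: "?S \<noteq> {}" by blast
  have contM: "continuous_on ?S (\<lambda>x. vec_norm_wrt B (M *v x))"
    using continuous_on_compose2[OF contn[of UNIV], of ?S "(*v) M"]
    by (simp add: matrix_vector_mult_linear_continuous_on)
  obtain x where x: "x \<in> ?S"
    and xmax: "\<And>y. y \<in> ?S \<Longrightarrow> vec_norm_wrt B (M *v y) \<le> vec_norm_wrt B (M *v x)"
    using continuous_attains_sup[OF comp ne contM] by blast
  have "mat_norm_wrt B M = vec_norm_wrt B (M *v x)"
    unfolding mat_norm_wrt_def by (rule cSup_eq_maximum) (use x xmax in auto)
  then show ?thesis using x xmax by auto
qed

end

theory Submission
  imports Defs
begin

text \<open>Let \<open>G = (I - Q Q\<^sup>* B) C\<close>. If \<open>G = 0\<close> the bound is trivial; otherwise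
  choose \<open>x\<close> of
  \<open>B\<close>-norm 1 with \<open>\<parallel>G x\<parallel>\<^sub>B = \<parallel>G\<parallel>\<^sub>B\<close>, let \<open>y\<close> be the \<open>B\<close>-unit vector in the direction of \<open>G x\<close>,
  and put \<open>v = G\<^sup>T B y\<close>. Then \<open>v \<bullet> z = \<langle>y, G z\<rangle>\<^sub>B\<close> for every \<open>z\<close>. The Cauchy--Schwarz inequality for
  the \<open>B\<close>-inner product bounds \<open>\<bar>v \<bullet> z\<bar>\<close> by \<open>\<parallel>G z\<parallel>\<^sub>B\<close>, while \<open>z = x\<close> gives
  \<open>\<parallel>G\<parallel>\<^sub>B = v \<bullet> x \<le> \<parallel>v\<parallel>\<^sub>2 \<parallel>x\<parallel>\<^sub>2 \<le> \<surd>\<parallel>B\<^sup>-\<^sup>1\<parallel>\<^sub>2 \<parallel>v\<parallel>\<^sub>2\<close> (lemma \<open>mat_norm_wrt_linear_witness\<close>).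

  The random variable \<open>v \<bullet> \<omega>\<^sub>i\<close> is normal with mean 0 and standard deviation \<open>\<parallel>v\<parallel>\<^sub>2\<close>, so its density
  never exceeds \<open>1 / (\<surd>(2 \<pi>) \<parallel>v\<parallel>\<^sub>2)\<close>. If \<open>\<omega>\<^sub>i\<close> fails to certify the bound, then \<open>v \<bullet> \<omega>\<^sub>i\<close> lies in
  the interval of half-width \<open>\<parallel>v\<parallel>\<^sub>2 \<surd>(\<pi>/2) / \<alpha>\<close> around 0, which has probability at most
  \<open>1 / \<alpha>\<close> (lemma \<open>prob_failure_single\<close>). The inequality for the maximum fails only if every
  \<open>\<omega>\<^sub>i\<close> fails, and by independence this has probability at most \<open>\<alpha>\<^sup>-\<^sup>r\<close>.\<close>


section \<open>The norm induced by a positive definite matrix\<close>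

lemma inner_symmetric_matrix:
  fixes B :: "real ^ 'n ^ 'n"
  assumes "symmetric_matrix B"
  shows "x \<bullet> (B *v y) = y \<bullet> (B *v x)"
  using assms unfolding symmetric_matrix_def
  by (metis dot_lmul_matrix inner_commute vector_transpose_matrix)

lemma pos_def_matrix_nonneg:
  assumes "pos_def_matrix B"
  shows "0 \<le> x \<bullet> (B *v x)"
  using assms by (cases "x = 0") (auto simp: pos_def_matrix_def less_imp_le)

lemma vec_norm_wrt_power2:
  assumes "pos_def_matrix B"
  shows "(vec_norm_wrt B x)\<^sup>2 = x \<bullet> (B *v x)"
  using pos_def_matrix_nonneg[OF assms] by (simp add: vec_norm_wrt_def)

lemma vec_norm_wrt_nonneg:
  assumes "pos_def_matrix B"
  shows "0 \<le> vec_norm_wrt B x"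
  using pos_def_matrix_nonneg[OF assms] by (simp add: vec_norm_wrt_def)

lemma pos_def_Cauchy_Schwarz:
  fixes B :: "real ^ 'n ^ 'n"
  assumes sym: "symmetric_matrix B" and pd: "pos_def_matrix B"
  shows "\<bar>x \<bullet> (B *v y)\<bar> \<le> vec_norm_wrt B x * vec_norm_wrt B y"
proof (cases "y = 0")
  case True
  then show ?thesis by (simp add: vec_norm_wrt_def)
next
  case False
  define p q c where "p = x \<bullet> (B *v x)" and "q = y \<bullet> (B *v y)" and "c = x \<bullet> (B *v y)"
  have q: "q > 0" using pd False by (auto simp: pos_def_matrix_def q_def)
  (* The B-orthogonal component of x relative to y has nonnegative square length. *)
  have "0 \<le> (x - (c / q) *\<^sub>R y) \<bullet> (B *v (x - (c / q) *\<^sub>R y))"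
    by (rule pos_def_matrix_nonneg[OF pd])
  also have "\<dots> = p - 2 * (c / q) * c + (c / q)\<^sup>2 * q"
    using inner_symmetric_matrix[OF sym, of y x]
    by (simp add: matrix_vector_mult_diff_distrib matrix_vector_mult_scaleR inner_diff_left
        inner_diff_right p_def q_def c_def power2_eq_square algebra_simps)
  also have "\<dots> = p - c\<^sup>2 / q"
    using q by (simp add: power2_eq_square field_simps)
  finally have "c\<^sup>2 \<le> p * q" using q by (simp add: field_simps)
  also have "\<dots> = (vec_norm_wrt B x * vec_norm_wrt B y)\<^sup>2"
    by (simp add: power_mult_distrib vec_norm_wrt_power2[OF pd] p_def q_def)
  finally show ?thesis
    unfolding c_def[symmetric]
    by (rule abs_le_square_iff[THEN iffD2, THEN order_trans])
       (simp add: vec_norm_wrt_nonneg[OF pd])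
qed

lemma pos_def_matrix_inv_right:
  fixes B :: "real ^ 'n ^ 'n"
  assumes "pos_def_matrix B"
  shows "B *v (matrix_inv B *v x) = x"
proof -
  have "x = 0" if "B *v x = 0" for x
    using assms that unfolding pos_def_matrix_def by (metis inner_zero_right less_irrefl)
  then have "invertible B"
    by (metis invertible_left_inverse matrix_left_invertible_ker)
  then have "B ** matrix_inv B = mat 1"
    unfolding matrix_inv_def invertible_def by (rule someI2_ex) blast
  then show ?thesis by (simp add: matrix_vector_mul_assoc)
qed

text \<open>Writing \<open>x \<bullet> x = \<langle>x, B\<^sup>-\<^sup>1 x\<rangle>\<^sub>B\<close>, the Cauchy--Schwarz inequality gives
  \<open>\<parallel>x\<parallel>\<^sup>2 \<le> \<parallel>x\<parallel>\<^sub>B \<surd>(x \<bullet> B\<^sup>-\<^sup>1 x) \<le> \<parallel>x\<parallel>\<^sub>B \<surd>\<parallel>B\<^sup>-\<^sup>1\<parallel> \<parallel>x\<parallel>\<close>. This replaces the usual argument by the smallest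
  eigenvalue of \<open>B\<close>.\<close>

lemma norm_le_vec_norm_wrt:
  fixes B :: "real ^ 'n ^ 'n"
  assumes sym: "symmetric_matrix B" and pd: "pos_def_matrix B"
  shows "norm x \<le> sqrt (onorm ((*v) (matrix_inv B))) * vec_norm_wrt B x"
proof (cases "x = 0")
  case True
  then show ?thesis by (simp add: vec_norm_wrt_def)
next
  case False
  define y where "y = matrix_inv B *v x"
  define b where "b = onorm ((*v) (matrix_inv B))"
  have By: "B *v y = x" by (simp add: y_def pos_def_matrix_inv_right[OF pd])
  have b0: "0 \<le> b" unfolding b_def by (intro onorm_pos_le) simp
  have "norm y \<le> b * norm x"
    unfolding y_def b_def by (intro onorm) simp
  then have "y \<bullet> x \<le> (b * norm x) * norm x"
    by (meson norm_cauchy_schwarz mult_right_mono norm_ge_zero order_trans)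
  then have "vec_norm_wrt B y \<le> sqrt (b * (norm x)\<^sup>2)"
    unfolding vec_norm_wrt_def By by (simp add: power2_eq_square mult_ac)
  then have y: "vec_norm_wrt B y \<le> sqrt b * norm x"
    by (simp add: real_sqrt_mult)
  have "norm x * norm x = x \<bullet> (B *v y)"
    by (simp add: By dot_square_norm power2_eq_square)
  also have "\<dots> \<le> vec_norm_wrt B x * vec_norm_wrt B y"
    using pos_def_Cauchy_Schwarz[OF sym pd, of x y] by linarith
  also have "\<dots> \<le> vec_norm_wrt B x * (sqrt b * norm x)"
    by (intro mult_left_mono y vec_norm_wrt_nonneg pd)
  finally have "norm x * norm x \<le> (sqrt b * vec_norm_wrt B x) * norm x"
    by (simp add: mult_ac)
  then show ?thesis
    using False unfolding b_def by simp
qed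

text \<open>A dual description of the induced norm: one linear functional, bounded by \<open>\<parallel>G z\<parallel>\<^sub>B\<close> at every
  \<open>z\<close>, already captures the size of \<open>G\<close>. It reduces the behaviour of \<open>G\<close> on a random vector to
  that of a scalar random variable.\<close>

lemma mat_norm_wrt_linear_witness:
  fixes B G :: "real ^ 'n ^ 'n"
  assumes sym: "symmetric_matrix B" and pd: "pos_def_matrix B"
  obtains v where "\<And>z. \<bar>v \<bullet> z\<bar> \<le> vec_norm_wrt B (G *v z)"
    and "mat_norm_wrt B G \<le> sqrt (onorm ((*v) (matrix_inv B))) * norm v"
proof -
  obtain x where x: "vec_norm_wrt B x = 1" "vec_norm_wrt B (G *v x) = mat_norm_wrt B G"
    using mat_norm_wrt_attained[OF pd] by blast
  define N where "N = mat_norm_wrt B G"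
  (* If N = 0 then y = 0, and both bounds hold with v = 0. *)
  define y where "y = (1 / N) *\<^sub>R (G *v x)"
  define v where "v = transpose G *v (B *v y)"
  have N0: "0 \<le> N"
    using vec_norm_wrt_nonneg[OF pd, of "G *v x"] x by (simp add: N_def)
  have vz: "v \<bullet> z = y \<bullet> (B *v (G *v z))" for z
  proof -
    have "v \<bullet> z = (B *v y) \<bullet> (G *v z)"
      unfolding v_def by (metis dot_lmul_matrix transpose_matrix_vector)
    then show ?thesis
      by (metis inner_commute inner_symmetric_matrix[OF sym])
  qed
  have GG: "(G *v x) \<bullet> (B *v (G *v x)) = N\<^sup>2"
    using vec_norm_wrt_power2[OF pd, of "G *v x"] x by (simp add: N_def)
  have "vec_norm_wrt B y \<le> 1"
    using N0 GG
    by (simp add: vec_norm_wrt_def y_def matrix_vector_mult_scaleR power2_eq_square)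
  then have "vec_norm_wrt B y * vec_norm_wrt B (G *v z) \<le> vec_norm_wrt B (G *v z)" for z
    by (intro mult_left_le_one_le vec_norm_wrt_nonneg[OF pd])
  then have 1: "\<bar>v \<bullet> z\<bar> \<le> vec_norm_wrt B (G *v z)" for z
    using pos_def_Cauchy_Schwarz[OF sym pd, of y "G *v z"] unfolding vz by (meson order_trans)
  have "N = v \<bullet> x"
    unfolding vz using GG by (simp add: y_def power2_eq_square)
  also have "\<dots> \<le> norm v * norm x" by (rule norm_cauchy_schwarz)
  also have "\<dots> \<le> norm v * sqrt (onorm ((*v) (matrix_inv B)))"
    using norm_le_vec_norm_wrt[OF sym pd, of x] x by (intro mult_left_mono) simp_all
  finally show thesis
    using that[of v] 1 by (simp add: N_def mult.commute)
qed


section \<open>Normal random vectors\<close>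

text \<open>The coordinates on which \<open>v\<close> vanishes are dropped from the sum: a normal variable has a
  density only when its variance is positive.\<close>

lemma (in prob_space) distributed_inner_std_normal_vector:
  fixes X :: "'a \<Rightarrow> real ^ 'n"
  assumes ind: "indep_vars (\<lambda>_. borel) (\<lambda>j w. X w $ j) UNIV"
    and dist: "\<And>j. distributed M lborel (\<lambda>w. X w $ j) std_normal_density"
    and v: "v \<noteq> 0"
  shows "distributed M lborel (\<lambda>w. v \<bullet> X w) (normal_density 0 (norm v))"
proof -
  define I where "I = {j. v $ j \<noteq> 0}"
  have I: "finite I" "I \<noteq> {}"
    using v by (auto simp: I_def vec_eq_iff)
  have "distributed M lborel (\<lambda>w. \<Sum>j\<in>I. v $ j * X w $ j)
          (normal_density (\<Sum>j\<in>I. 0) (sqrt (\<Sum>j\<in>I. \<bar>v $ j\<bar>\<^sup>2)))"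
  proof (rule sum_indep_normal[OF I])
    show "indep_vars (\<lambda>_. borel) (\<lambda>j w. v $ j * X w $ j) I"
      by (rule indep_vars_compose2[OF indep_vars_subset[OF ind]]) auto
    show "distributed M lborel (\<lambda>w. v $ j * X w $ j) (normal_density 0 \<bar>v $ j\<bar>)" if "j \<in> I" for j
      using normal_density_affine[OF dist, of "v $ j" 0] that by (simp add: I_def)
  qed (simp add: I_def)
  moreover have "(\<Sum>j\<in>I. v $ j * X w $ j) = v \<bullet> X w" for w
    unfolding inner_vec_def inner_real_def
    by (rule sum.mono_neutral_left) (auto simp: I_def)
  moreover have "(\<Sum>j\<in>I. \<bar>v $ j\<bar>\<^sup>2) = (\<Sum>j\<in>UNIV. (v $ j)\<^sup>2)"
    by (subst power2_abs, rule sum.mono_neutral_left) (auto simp: I_def)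
  then have "sqrt (\<Sum>j\<in>I. \<bar>v $ j\<bar>\<^sup>2) = norm v"
    by (simp add: norm_vec_def L2_set_def)
  ultimately show ?thesis by simp
qed

lemma normal_density_le_peak:
  "normal_density \<mu> \<sigma> x \<le> 1 / sqrt (2 * pi * \<sigma>\<^sup>2)"
  unfolding normal_density_def by (rule mult_left_le) simp_all

lemma (in prob_space) prob_normal_small_ball:
  assumes X: "distributed M lborel X (normal_density 0 \<sigma>)"
    and "0 < \<sigma>" "0 \<le> t"
  shows "prob (X -` {-t..t} \<inter> space M) \<le> 2 * t / (sqrt (2 * pi) * \<sigma>)"
proof -
  define K where "K = 1 / sqrt (2 * pi * \<sigma>\<^sup>2)"
  have K: "K = 1 / (sqrt (2 * pi) * \<sigma>)" "0 \<le> K"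
    using assms by (simp_all add: K_def real_sqrt_mult)
  have "emeasure M (X -` {-t..t} \<inter> space M)
      = (\<integral>\<^sup>+x. ennreal (normal_density 0 \<sigma> x) * indicator {-t..t} x \<partial>lborel)"
    by (rule distributed_emeasure[OF X]) simp
  also have "\<dots> \<le> (\<integral>\<^sup>+x. ennreal K * indicator {-t..t} x \<partial>lborel)"
    unfolding K_def
    by (intro nn_integral_mono mult_right_mono ennreal_leI normal_density_le_peak) simp
  also have "\<dots> = ennreal K * emeasure lborel {-t..t}"
    by (rule nn_integral_cmult_indicator) simp
  also have "\<dots> = ennreal (K * (2 * t))"
    using assms K(2) by (simp add: ennreal_mult)
  finally have "prob (X -` {-t..t} \<inter> space M) \<le> K * (2 * t)"
    using assms K by (simp add: emeasure_eq_measure)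
  then show ?thesis by (simp add: K)
qed


section \<open>Estimating the norm from random vectors\<close>

text \<open>By \<open>mat_norm_wrt_linear_witness\<close>, failure forces \<open>\<bar>v \<bullet> X\<bar>\<close> to be below
  \<open>\<parallel>G\<parallel>\<^sub>B / (\<alpha> \<surd>(2 \<parallel>B\<^sup>-\<^sup>1\<parallel> / \<pi>)) \<le> \<parallel>v\<parallel> \<surd>(\<pi>/2) / \<alpha>\<close>. The constant \<open>\<surd>(2 / \<pi>)\<close> is the peak of the standard
  normal density times the length 2 of \<open>[-1, 1]\<close>; it makes the resulting bound exactly \<open>1 / \<alpha>\<close>.\<close>

lemma (in prob_space) prob_failure_single:
  fixes B G :: "real ^ 'n ^ 'n" and X :: "'a \<Rightarrow> real ^ 'n"
  assumes sym: "symmetric_matrix B" and pd: "pos_def_matrix B"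
    and ind: "indep_vars (\<lambda>_. borel) (\<lambda>j w. X w $ j) UNIV"
    and dist: "\<And>j. distributed M lborel (\<lambda>w. X w $ j) std_normal_density"
    and \<alpha>: "\<alpha> > 0"
  shows "prob {w \<in> space M. \<alpha> * sqrt (2 * onorm ((*v) (matrix_inv B)) / pi)
             * vec_norm_wrt B (G *v X w) < mat_norm_wrt B G} \<le> 1 / \<alpha>"
    (is "prob ?F \<le> _")
proof -
  define b where "b = onorm ((*v) (matrix_inv B))"
  obtain v where v: "\<And>z. \<bar>v \<bullet> z\<bar> \<le> vec_norm_wrt B (G *v z)"
    and N: "mat_norm_wrt B G \<le> sqrt b * norm v"
    using mat_norm_wrt_linear_witness[OF sym pd, of G] unfolding b_def by blast
  have b0: "0 \<le> b" unfolding b_def by (intro onorm_pos_le) simp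
  have c0: "0 \<le> \<alpha> * sqrt (2 * b / pi)" using b0 \<alpha> by simp
  show ?thesis
  proof (cases "sqrt b * norm v = 0")
    case True
    have "0 \<le> \<alpha> * sqrt (2 * b / pi) * vec_norm_wrt B (G *v X w)" for w
      by (intro mult_nonneg_nonneg c0 vec_norm_wrt_nonneg[OF pd])
    then have "?F = {}"
      using N True unfolding b_def[symmetric] by (auto simp: not_less intro: order_trans)
    show ?thesis unfolding \<open>?F = {}\<close> using \<alpha> by simp
  next
    case False
    then have b: "0 < b" and v0: "v \<noteq> 0" using b0 by auto
    define t where "t = norm v * sqrt (pi / 2) / \<alpha>"
    have t0: "0 \<le> t" using \<alpha> by (simp add: t_def)
    have D: "distributed M lborel (\<lambda>w. v \<bullet> X w) (normal_density 0 (norm v))"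
      by (rule distributed_inner_std_normal_vector[OF ind dist v0])
    have ct: "\<alpha> * sqrt (2 * b / pi) * t = sqrt b * norm v"
      using \<alpha> by (simp add: t_def real_sqrt_mult real_sqrt_divide)
    have "?F \<subseteq> (\<lambda>w. v \<bullet> X w) -` {-t..t} \<inter> space M"
    proof
      fix w assume w: "w \<in> ?F"
      then have "\<alpha> * sqrt (2 * b / pi) * vec_norm_wrt B (G *v X w)
          < \<alpha> * sqrt (2 * b / pi) * t"
        using N unfolding ct b_def[symmetric] by simp
      then have "vec_norm_wrt B (G *v X w) < t"
        using c0 by (rule mult_left_less_imp_less)
      then have "\<bar>v \<bullet> X w\<bar> \<le> t" using v[of "X w"] by linarith
      then show "w \<in> (\<lambda>w. v \<bullet> X w) -` {-t..t} \<inter> space M"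
        using w by (simp add: abs_le_iff)
    qed
    then have "prob ?F \<le> prob ((\<lambda>w. v \<bullet> X w) -` {-t..t} \<inter> space M)"
      using D by (intro finite_measure_mono) (auto simp: distributed_def)
    also have "\<dots> \<le> 2 * t / (sqrt (2 * pi) * norm v)"
      by (rule prob_normal_small_ball[OF D]) (use v0 t0 in auto)
    also have "\<dots> = 1 / \<alpha>"
      using v0 \<alpha> by (simp add: t_def real_sqrt_mult real_sqrt_divide field_simps)
    finally show ?thesis .
  qed
qed

text \<open>The bound holds for the maximum unless every \<open>X\<^sub>i\<close> violates it, so the failure event is an
  intersection of \<open>r\<close> independent events.\<close>

lemma (in prob_space) prob_mat_norm_wrt_le_Max:
  fixes B G :: "real ^ 'n ^ 'n" and X :: "nat \<Rightarrow> 'a \<Rightarrow> real ^ 'n"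
  assumes sym: "symmetric_matrix B" and pd: "pos_def_matrix B"
    and r: "r > 0" and \<alpha>: "\<alpha> > 0"
    and indX: "indep_vars (\<lambda>_. borel) X {1..r}"
    and ind: "\<And>i. i \<in> {1..r} \<Longrightarrow> indep_vars (\<lambda>_. borel) (\<lambda>j w. X i w $ j) UNIV"
    and dist: "\<And>i j. i \<in> {1..r} \<Longrightarrow> distributed M lborel (\<lambda>w. X i w $ j) std_normal_density"
  shows "prob {w \<in> space M. mat_norm_wrt B G
             \<le> \<alpha> * sqrt (2 * onorm ((*v) (matrix_inv B)) / pi)
               * (MAX i\<in>{1..r}. vec_norm_wrt B (G *v X i w))} \<ge> 1 - (1 / \<alpha>) ^ r"
    (is "prob ?S \<ge> _")
proof -
  define c where "c = \<alpha> * sqrt (2 * onorm ((*v) (matrix_inv B)) / pi)"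
  define E where "E = {z. c * vec_norm_wrt B (G *v z) < mat_norm_wrt B G}"
  have c0: "0 \<le> c"
    unfolding c_def using \<alpha>
    by (intro mult_nonneg_nonneg real_sqrt_ge_zero divide_nonneg_nonneg onorm_pos_le) simp_all
  have ne: "{1..r} \<noteq> {}" using r by simp
  have "open E"
    unfolding E_def vec_norm_wrt_def
    by (intro open_Collect_less continuous_intros matrix_vector_mult_linear_continuous_on
        continuous_on_compose2[OF matrix_vector_mult_linear_continuous_on[of UNIV B]]) simp
  then have E: "E \<in> sets borel" by simp
  have max_iff: "mat_norm_wrt B G \<le> c * (MAX i\<in>{1..r}. vec_norm_wrt B (G *v X i w))
      \<longleftrightarrow> (\<exists>i\<in>{1..r}. X i w \<notin> E)" for w
  proof -
    have "c * (MAX i\<in>{1..r}. vec_norm_wrt B (G *v X i w))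
        = (MAX i\<in>{1..r}. c * vec_norm_wrt B (G *v X i w))"
      using mono_Max_commute[of "(*) c" "(\<lambda>i. vec_norm_wrt B (G *v X i w)) ` {1..r}"] ne c0
      by (simp add: image_image mono_def mult_left_mono)
    then show ?thesis
      using ne by (simp add: Max_ge_iff E_def not_less)
  qed
  define F where "F = (\<Inter>i\<in>{1..r}. X i -` E \<inter> space M)"
  have S: "?S = space M - F"
    unfolding c_def[symmetric] max_iff F_def using ne by auto
  have meas: "X i -` E \<inter> space M \<in> events" if "i \<in> {1..r}" for i
    using indX that E unfolding indep_vars_def by (auto intro: measurable_sets)
  have "prob F = (\<Prod>i\<in>{1..r}. prob (X i -` E \<inter> space M))"
    unfolding F_def by (rule indep_varsD_finite[OF indX ne]) (use E in auto)
  also have "\<dots> \<le> (\<Prod>i\<in>{1..r}. 1 / \<alpha>)"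
  proof (intro prod_mono conjI measure_nonneg)
    fix i assume i: "i \<in> {1..r}"
    have "X i -` E \<inter> space M
        = {w \<in> space M. c * vec_norm_wrt B (G *v X i w) < mat_norm_wrt B G}"
      by (auto simp: E_def)
    then show "prob (X i -` E \<inter> space M) \<le> 1 / \<alpha>"
      using prob_failure_single[OF sym pd ind[OF i] dist[OF i] \<alpha>, of G] by (simp add: c_def)
  qed
  finally have "prob F \<le> (1 / \<alpha>) ^ r" by simp
  moreover have "F \<in> events"
    unfolding F_def using meas ne by (intro sets.finite_INT) auto
  ultimately show ?thesis
    unfolding S by (simp add: prob_compl)
qed


section \<open>The bound for the projected matrix\<close>

theorem proposition1:
  fixes A B C :: "real ^ 'n ^ 'n"
    and Q :: "real ^ 'm ^ 'n"
    and M :: "'w measure"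
    and \<omega> :: "nat \<Rightarrow> 'w \<Rightarrow> real ^ 'n"
    and r :: nat
    and \<alpha> :: real
  assumes "symmetric_matrix A"
    and "symmetric_matrix B" and "pos_def_matrix B"
    and "C = matrix_inv B ** A"
    and "transpose Q ** B ** Q = mat 1"
    and "r > 0"
    and "\<alpha> > 1"
    and "prob_space M"
    and "prob_space.indep_vars M (\<lambda>_. borel) \<omega> {1..r}"
    and "\<And>i. i \<in> {1..r} \<Longrightarrow> prob_space.indep_vars M (\<lambda>_. borel) (\<lambda>j w. \<omega> i w $ j) UNIV"
    and "\<And>i j. i \<in> {1..r} \<Longrightarrow> distributed M lborel (\<lambda>w. \<omega> i w $ j) std_normal_density"
  shows "measure M {w \<in> space M.
           mat_norm_wrt B ((mat 1 - Q ** transpose Q ** B) ** C)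
             \<le> \<alpha> * sqrt (2 * onorm ((*v) (matrix_inv B)) / pi)
                 * (MAX i\<in>{1..r}. vec_norm_wrt B (((mat 1 - Q ** transpose Q ** B) ** C) *v \<omega> i w))}
         \<ge> 1 - \<alpha> powi (- int r)"
proof -
  interpret prob_space M by fact
  have "\<alpha> powi (- int r) = (1 / \<alpha>) ^ r"
    by (simp add: power_int_minus power_one_over inverse_eq_divide)
  then show ?thesis
    using prob_mat_norm_wrt_le_Max[where X = \<omega> and \<alpha> = \<alpha> and r = r and B = B
        and G = "(mat 1 - Q ** transpose Q ** B) ** C"] assms by simp
qed

end
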